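(* Suppose that $p:B\to G$ is a Fell bundle over a discrete group $G$, and that $\sigma\in Z^2(G,\mathbb{T})$ is a $2$-cocycle. Then there is a Fell bundle $p:B(\sigma)\to G$ with the same underlying set $B$, the same projection $p$, the same Banach space structures on the fibres, and the other operations given in terms of those in $B$ by \[ b\cdot_\sigma c=\sigma(g,h)\,bc\quad\text{and}\quad b^{*_\sigma}=\overline{\sigma(g,g^{-1})}\,b^*\qquad\text{for } b\in B_g \text{ and } c\in B_h . \]
   Context: A Banach bundle over a set $X$ is a set $B$ with a function $p:B\to X$ (the projection) such that each fibre $B_x:=p^{-1}(x)$ has the structure of a complex Banach space. A Fell bundle over a discrete group $G$ with identity $e$ is a Banach bundle $p:B\to G$ together with an associative multiplication and an involution on $B$ such that: (1) $p(bc)=p(b)p(c)$ for all $b,c\in B$; (2) for all $g,h\in G$ the map $(b,c)\mapsto bc$ is bilinear from $B_g\times B_h$ to $B_{gh}$ and $\|bc\|\le\|b\|\,\|c\|$; (3) for every $g\in G$ the map $b\mapsto b^*$ is conjugate linear from $B_g$ to $B_{g^{-1}}$, and satisfies $(bc)^*=c^*b^*$ and $\|b^*b\|=\|b\|^2$ (so that $B_e$ is a $C^*$-algebra); (4) $b^*b\ge 0$ in $B_e$ for all $b\in B$. A $2$-cocycle $\sigma\in Z^2(G,\mathbb{T})$ is a function $\sigma:G\times G\to\mathbb{T}$ with $\sigma(e,g)=\sigma(g,e)=1$ for all $g$ and $\sigma(g,h)\sigma(gh,k)=\sigma(g,hk)\sigma(h,k)$ for all $g,h,k\in G$; here $\mathbb{T}$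 is the circle group. *)

theory Defs
  imports "HOL-Algebra.Group" "HOL-Analysis.Analysis"
begin

locale complex_normed_space =
  fixes V :: "'b set"
    and vadd :: "'b \<Rightarrow> 'b \<Rightarrow> 'b"
    and vzero :: 'b
    and vscale :: "complex \<Rightarrow> 'b \<Rightarrow> 'b"
    and vnorm :: "'b \<Rightarrow> real"
  assumes comm_group_vadd: "comm_group \<lparr>carrier = V, monoid.mult = vadd, one = vzero\<rparr>"
    and vscale_closed: "x \<in> V \<Longrightarrow> vscale a x \<in> V"
    and vscale_vadd: "x \<in> V \<Longrightarrow> y \<in> V \<Longrightarrow> vscale a (vadd x y) = vadd (vscale a x) (vscale a y)"
    and vscale_add_left: "x \<in> V \<Longrightarrow> vscale (a + c) x = vadd (vscale a x) (vscale c x)"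
    and vscale_vscale: "x \<in> V \<Longrightarrow> vscale a (vscale c x) = vscale (a * c) x"
    and vscale_one: "x \<in> V \<Longrightarrow> vscale 1 x = x"
    and vnorm_nonneg: "x \<in> V \<Longrightarrow> 0 \<le> vnorm x"
    and vnorm_eq_0_iff: "x \<in> V \<Longrightarrow> vnorm x = 0 \<longleftrightarrow> x = vzero"
    and vnorm_triangle: "x \<in> V \<Longrightarrow> y \<in> V \<Longrightarrow> vnorm (vadd x y) \<le> vnorm x + vnorm y"
    and vnorm_vscale: "x \<in> V \<Longrightarrow> vnorm (vscale a x) = cmod a * vnorm x"
begin

text \<open>The value outside \<open>V\<close> is irrelevant; it is set to \<open>0\<close> because the locale
  \<^locale>\<open>Metric_space\<close> requires a distance that is nonnegative and symmetric on the whole type.\<close>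

definition vdist :: "'b \<Rightarrow> 'b \<Rightarrow> real" where
  "vdist x y = (if x \<in> V \<and> y \<in> V then vnorm (vadd x (vscale (-1) y)) else 0)"

lemma vadd_closed: "x \<in> V \<Longrightarrow> y \<in> V \<Longrightarrow> vadd x y \<in> V"
  using comm_group.axioms(2)[OF comm_group_vadd] group.is_monoid monoid.m_closed by fastforce

lemma vadd_assoc:
  "x \<in> V \<Longrightarrow> y \<in> V \<Longrightarrow> z \<in> V \<Longrightarrow> vadd (vadd x y) z = vadd x (vadd y z)"
  using monoid.m_assoc[OF group.is_monoid[OF comm_group.axioms(2)[OF comm_group_vadd]]] by simp

lemma vadd_commute: "x \<in> V \<Longrightarrow> y \<in> V \<Longrightarrow> vadd x y = vadd y x"
  using comm_monoid.m_comm[OF comm_group.axioms(1)[OF comm_group_vadd]] by simp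

lemma vzero_closed: "vzero \<in> V"
  using monoid.one_closed[OF group.is_monoid[OF comm_group.axioms(2)[OF comm_group_vadd]]] by simp

lemma vadd_zero: "x \<in> V \<Longrightarrow> vadd vzero x = x" "x \<in> V \<Longrightarrow> vadd x vzero = x"
  using monoid.l_one[OF group.is_monoid[OF comm_group.axioms(2)[OF comm_group_vadd]]]
    monoid.r_one[OF group.is_monoid[OF comm_group.axioms(2)[OF comm_group_vadd]]] by simp_all

lemma vscale_zero: "x \<in> V \<Longrightarrow> vscale 0 x = vzero"
  using vnorm_eq_0_iff[OF vscale_closed, of x 0] by (simp add: vnorm_vscale)

lemma vadd_uminus: "x \<in> V \<Longrightarrow> vadd x (vscale (-1) x) = vzero"
  using vscale_add_left[of x 1 "-1"] by (simp add: vscale_one vscale_zero)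

lemma Metric_space_vdist: "Metric_space V vdist"
proof
  show "0 \<le> vdist x y" for x y
    by (simp add: vdist_def vnorm_nonneg vadd_closed vscale_closed)
  show "vdist x y = vdist y x" for x y
  proof (cases "x \<in> V \<and> y \<in> V")
    case True
    have "vscale (-1) (vadd x (vscale (-1) y)) = vadd y (vscale (-1) x)"
      using True by (simp add: vscale_vadd vscale_closed vscale_vscale vscale_one vadd_commute)
    then show ?thesis
      using True vnorm_vscale[of "vadd x (vscale (-1) y)" "-1"]
      by (simp add: vdist_def vadd_closed vscale_closed)
  qed (auto simp: vdist_def)
  show "vdist x y = 0 \<longleftrightarrow> x = y" if xy: "x \<in> V" "y \<in> V" for x y
  proof
    assume "vdist x y = 0"
    then have 0: "vadd x (vscale (-1) y) = vzero"
      using xy by (simp add: vdist_def vnorm_eq_0_iff vadd_closed vscale_closed)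
    have "x = vadd x (vadd (vscale (-1) y) y)"
      using xy by (simp add: vadd_zero vadd_uminus vadd_commute vscale_closed)
    also have "\<dots> = y"
      using xy 0 by (simp add: vadd_assoc[symmetric] vscale_closed vadd_zero)
    finally show "x = y" .
  next
    assume "x = y"
    then show "vdist x y = 0"
      using xy by (simp add: vdist_def vadd_uminus vnorm_eq_0_iff vzero_closed)
  qed
  show "vdist x z \<le> vdist x y + vdist y z" if xyz: "x \<in> V" "y \<in> V" "z \<in> V" for x y z
  proof -
    let ?u = "vadd x (vscale (-1) y)" and ?v = "vadd y (vscale (-1) z)"
    have "vadd ?u ?v = vadd x (vadd (vadd (vscale (-1) y) y) (vscale (-1) z))"
      using xyz by (simp add: vadd_assoc vadd_closed vscale_closed)
    also have "\<dots> = vadd x (vscale (-1) z)"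
      using xyz by (simp add: vadd_commute[of "vscale (-1) y" y] vadd_uminus vadd_zero vscale_closed)
    finally show ?thesis
      using vnorm_triangle[of ?u ?v] xyz by (simp add: vdist_def vadd_closed vscale_closed)
  qed
qed

end

sublocale complex_normed_space \<subseteq> Metric_space V vdist
  by (rule Metric_space_vdist)

locale complex_banach_space = complex_normed_space +
  assumes complete: mcomplete

definition fibre :: "'b set \<Rightarrow> ('b \<Rightarrow> 'x) \<Rightarrow> 'x \<Rightarrow> 'b set" where
  "fibre B p x = {b \<in> B. p b = x}"

text \<open>The operations are only constrained on the fibres: \<open>add b c\<close> is
  meaningful when \<open>b\<close> and \<open>c\<close> lie in the same fibre, and \<open>zero x\<close>
  is the zero vector of the fibre over \<open>x\<close>.\<close>

locale banach_bundle =
  fixes X :: "'x set"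
    and B :: "'b set"
    and p :: "'b \<Rightarrow> 'x"
    and add :: "'b \<Rightarrow> 'b \<Rightarrow> 'b"
    and zero :: "'x \<Rightarrow> 'b"
    and smul :: "complex \<Rightarrow> 'b \<Rightarrow> 'b"
    and nrm :: "'b \<Rightarrow> real"
  assumes proj_closed: "b \<in> B \<Longrightarrow> p b \<in> X"
    and banach_fibre: "x \<in> X \<Longrightarrow> complex_banach_space (fibre B p x) add (zero x) smul nrm"

text \<open>The multiplicative monoid of the unitization of a complex algebra \<open>A\<close>; the pair
  \<open>(a, l)\<close> stands for \<open>a + l 1\<close>.\<close>

definition unitization ::
  "'b set \<Rightarrow> ('b \<Rightarrow> 'b \<Rightarrow> 'b) \<Rightarrow> 'b \<Rightarrow> (complex \<Rightarrow> 'b \<Rightarrow> 'b) \<Rightarrow> ('b \<Rightarrow> 'b \<Rightarrow> 'b) \<Rightarrow>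
    ('b \<times> complex) monoid" where
  "unitization A add z smul mul =
    \<lparr>carrier = A \<times> UNIV,
     monoid.mult = (\<lambda>(a, l) (b, m). (add (mul a b) (add (smul l b) (smul m a)), l * m)),
     one = (z, 1)\<rparr>"

text \<open>The spectrum is taken in the unitization, so that \<open>A\<close> need not have an identity. If
  \<open>A\<close> is unital, this differs from the spectrum in \<open>A\<close> at most by the point \<open>0\<close>,
  which does not affect positivity.\<close>

definition spectrum ::
  "'b set \<Rightarrow> ('b \<Rightarrow> 'b \<Rightarrow> 'b) \<Rightarrow> 'b \<Rightarrow> (complex \<Rightarrow> 'b \<Rightarrow> 'b) \<Rightarrow> ('b \<Rightarrow> 'b \<Rightarrow> 'b) \<Rightarrow>
    'b \<Rightarrow> complex set" where
  "spectrum A add z smul mul a = {l. (a, - l) \<notin> Units (unitization A add z smul mul)}"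

definition cstar_positive ::
  "'b set \<Rightarrow> ('b \<Rightarrow> 'b \<Rightarrow> 'b) \<Rightarrow> 'b \<Rightarrow> (complex \<Rightarrow> 'b \<Rightarrow> 'b) \<Rightarrow> ('b \<Rightarrow> 'b \<Rightarrow> 'b) \<Rightarrow>
    ('b \<Rightarrow> 'b) \<Rightarrow> 'b \<Rightarrow> bool" where
  "cstar_positive A add z smul mul star a \<longleftrightarrow>
    a \<in> A \<and> star a = a \<and> spectrum A add z smul mul a \<subseteq> \<real>\<^sub>\<ge>\<^sub>0"

locale fell_bundle =
  group G + banach_bundle "carrier G" B p add zero smul nrm
  for G :: "('g, 'm) monoid_scheme" (structure)
    and B :: "'b set" and p add zero smul nrm +
  fixes mul :: "'b \<Rightarrow> 'b \<Rightarrow> 'b"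
    and star :: "'b \<Rightarrow> 'b"
  assumes mul_closed: "b \<in> B \<Longrightarrow> c \<in> B \<Longrightarrow> mul b c \<in> B"
    and mul_assoc: "b \<in> B \<Longrightarrow> c \<in> B \<Longrightarrow> d \<in> B \<Longrightarrow> mul (mul b c) d = mul b (mul c d)"
    and proj_mul: "b \<in> B \<Longrightarrow> c \<in> B \<Longrightarrow> p (mul b c) = p b \<otimes> p c"
    and mul_add_left: "g \<in> carrier G \<Longrightarrow> h \<in> carrier G \<Longrightarrow>
      b \<in> fibre B p g \<Longrightarrow> b' \<in> fibre B p g \<Longrightarrow> c \<in> fibre B p h \<Longrightarrow>
      mul (add b b') c = add (mul b c) (mul b' c)"
    and mul_add_right: "g \<in> carrier G \<Longrightarrow> h \<in> carrier G \<Longrightarrow>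
      b \<in> fibre B p g \<Longrightarrow> c \<in> fibre B p h \<Longrightarrow> c' \<in> fibre B p h \<Longrightarrow>
      mul b (add c c') = add (mul b c) (mul b c')"
    and mul_smul_left: "b \<in> B \<Longrightarrow> c \<in> B \<Longrightarrow> mul (smul l b) c = smul l (mul b c)"
    and mul_smul_right: "b \<in> B \<Longrightarrow> c \<in> B \<Longrightarrow> mul b (smul l c) = smul l (mul b c)"
    and nrm_mul: "b \<in> B \<Longrightarrow> c \<in> B \<Longrightarrow> nrm (mul b c) \<le> nrm b * nrm c"
    and star_fibre: "g \<in> carrier G \<Longrightarrow> b \<in> fibre B p g \<Longrightarrow> star b \<in> fibre B p (inv g)"
    and star_add: "g \<in> carrier G \<Longrightarrow> b \<in> fibre B p g \<Longrightarrow> c \<in> fibre B p g \<Longrightarrow>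
      star (add b c) = add (star b) (star c)"
    and star_smul: "b \<in> B \<Longrightarrow> star (smul l b) = smul (cnj l) (star b)"
    and star_star: "b \<in> B \<Longrightarrow> star (star b) = b"
    and star_mul: "b \<in> B \<Longrightarrow> c \<in> B \<Longrightarrow> star (mul b c) = mul (star c) (star b)"
    and nrm_star_mul: "b \<in> B \<Longrightarrow> nrm (mul (star b) b) = (nrm b)\<^sup>2"
    and star_mul_positive: "b \<in> B \<Longrightarrow>
      cstar_positive (fibre B p \<one>) add (zero \<one>) smul mul star (mul (star b) b)"

definition two_cocycle :: "('g, 'm) monoid_scheme \<Rightarrow> ('g \<Rightarrow> 'g \<Rightarrow> complex) \<Rightarrow> bool" where
  "two_cocycle G \<sigma> \<longleftrightarrow>
    (\<forall>g\<in>carrier G. \<forall>h\<in>carrier G. \<sigma> g h \<in> sphere 0 1) \<and>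
    (\<forall>g\<in>carrier G. \<sigma> \<one>\<^bsub>G\<^esub> g = 1 \<and> \<sigma> g \<one>\<^bsub>G\<^esub> = 1) \<and>
    (\<forall>g\<in>carrier G. \<forall>h\<in>carrier G. \<forall>k\<in>carrier G.
      \<sigma> g h * \<sigma> (g \<otimes>\<^bsub>G\<^esub> h) k = \<sigma> g (h \<otimes>\<^bsub>G\<^esub> k) * \<sigma> h k)"

end

theory Submission
  imports Defs
begin

text \<open>Multiplying by unimodular scalars changes no norms. The cocycle identity at \<open>(g, h, k)\<close> gives
  associativity, at \<open>(g, g\<inverse>, g)\<close> it gives \<open>\<sigma>(g, g\<inverse>) = \<sigma>(g\<inverse>, g)\<close>, so the new involution is
  involutive and the new \<open>b\<^sup>* b\<close> is the old one, and at \<open>(g, h, (gh)\<inverse>)\<close> and \<open>(h, h\<inverse>, g\<inverse>)\<close> it gives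
  antimultiplicativity of the involution. Since \<open>\<sigma>\<close> is normalised, the operations on the fibre
  over the identity, and hence positivity there, are unchanged.\<close>

lemma Units_cong:
  assumes "carrier M = carrier N" and "\<one>\<^bsub>M\<^esub> = \<one>\<^bsub>N\<^esub>"
    and "\<And>x y. x \<in> carrier N \<Longrightarrow> y \<in> carrier N \<Longrightarrow> x \<otimes>\<^bsub>M\<^esub> y = x \<otimes>\<^bsub>N\<^esub> y"
  shows "Units M = Units N"
  using assms by (auto simp: Units_def)

text \<open>The product of the unitization evaluates \<open>mul\<close> only at pairs from
  \<open>A\<close>, so values of \<open>mul\<close> elsewhere cannot affect invertibility.\<close>

lemma spectrum_cong:
  assumes "\<And>a b. a \<in> A \<Longrightarrow> b \<in> A \<Longrightarrow> mul a b = mul' a b"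
  shows "spectrum A add z smul mul = spectrum A add z smul mul'"
proof -
  have "Units (unitization A add z smul mul) = Units (unitization A add z smul mul')"
    by (rule Units_cong) (auto simp: unitization_def assms)
  then show ?thesis
    by (simp add: spectrum_def fun_eq_iff)
qed

text \<open>Needed because the old and new operations are different functions on the whole type and
  agree only on the fibre over the identity, which will be \<open>A\<close>.\<close>

lemma cstar_positive_cong:
  assumes "\<And>a b. a \<in> A \<Longrightarrow> b \<in> A \<Longrightarrow> mul a b = mul' a b"
    and "\<And>a. a \<in> A \<Longrightarrow> star a = star' a"
  shows "cstar_positive A add z smul mul star a \<longleftrightarrow> cstar_positive A add z smul mul' star' a"
  using spectrum_cong[OF assms(1)] assms(2) by (auto simp: cstar_positive_def)

context fell_bundle
begin

lemma smul_fibre: "g \<in> carrier G \<Longrightarrow> b \<in> fibre B p g \<Longrightarrow> smul l b \<in> fibre B p g"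
  using complex_normed_space.vscale_closed[OF complex_banach_space.axioms(1)[OF banach_fibre]] .

lemma add_fibre:
  "g \<in> carrier G \<Longrightarrow> b \<in> fibre B p g \<Longrightarrow> c \<in> fibre B p g \<Longrightarrow> add b c \<in> fibre B p g"
  using complex_normed_space.vadd_closed[OF complex_banach_space.axioms(1)[OF banach_fibre]] .

text \<open>The vector space axioms are stated fibre by fibre; taking the fibre over
  \<open>p b\<close> frees them from the group element.\<close>

lemma smul_closed: "b \<in> B \<Longrightarrow> smul l b \<in> B"
  and proj_smul: "b \<in> B \<Longrightarrow> p (smul l b) = p b"
  using smul_fibre[of "p b" b l] by (auto simp: fibre_def proj_closed)

lemma smul_smul: "b \<in> B \<Longrightarrow> smul l (smul m b) = smul (l * m) b"
  using complex_normed_space.vscale_vscale[OF complex_banach_space.axioms(1)[OF banach_fibre],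
      of "p b" b] by (simp add: fibre_def proj_closed)

lemma smul_one: "b \<in> B \<Longrightarrow> smul 1 b = b"
  using complex_normed_space.vscale_one[OF complex_banach_space.axioms(1)[OF banach_fibre],
      of "p b" b] by (simp add: fibre_def proj_closed)

lemma nrm_smul: "b \<in> B \<Longrightarrow> nrm (smul l b) = cmod l * nrm b"
  using complex_normed_space.vnorm_vscale[OF complex_banach_space.axioms(1)[OF banach_fibre],
      of "p b" b] by (simp add: fibre_def proj_closed)

lemma smul_add:
  "g \<in> carrier G \<Longrightarrow> b \<in> fibre B p g \<Longrightarrow> c \<in> fibre B p g \<Longrightarrow>
    smul l (add b c) = add (smul l b) (smul l c)"
  using complex_normed_space.vscale_vadd[OF complex_banach_space.axioms(1)[OF banach_fibre]] .

lemma star_closed: "b \<in> B \<Longrightarrow> star b \<in> B"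
  and proj_star: "b \<in> B \<Longrightarrow> p (star b) = inv (p b)"
  using star_fibre[of "p b" b] by (auto simp: fibre_def proj_closed)

lemma mul_fibre:
  "b \<in> fibre B p g \<Longrightarrow> c \<in> fibre B p h \<Longrightarrow> mul b c \<in> fibre B p (g \<otimes> h)"
  by (auto simp: fibre_def mul_closed proj_mul)

end

locale twisted_fell_bundle = fell_bundle +
  fixes \<sigma> :: "'a \<Rightarrow> 'a \<Rightarrow> complex"
  assumes two_cocycle: "two_cocycle G \<sigma>"
begin

text \<open>The group elements indexing the cocycle are recovered through \<open>p\<close>, which
  makes the product a function of \<open>b\<close> and \<open>c\<close> alone.\<close>

definition twisted_mul where
  "twisted_mul b c = smul (\<sigma> (p b) (p c)) (mul b c)"

definition twisted_star where
  "twisted_star b = smul (cnj (\<sigma> (p b) (inv (p b)))) (star b)"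

lemma cmod_cocycle: "g \<in> carrier G \<Longrightarrow> h \<in> carrier G \<Longrightarrow> cmod (\<sigma> g h) = 1"
  using two_cocycle by (simp add: two_cocycle_def)

lemma cocycle_one: "g \<in> carrier G \<Longrightarrow> \<sigma> \<one> g = 1" "g \<in> carrier G \<Longrightarrow> \<sigma> g \<one> = 1"
  using two_cocycle by (simp_all add: two_cocycle_def)

lemma cocycle:
  "g \<in> carrier G \<Longrightarrow> h \<in> carrier G \<Longrightarrow> k \<in> carrier G \<Longrightarrow>
    \<sigma> g h * \<sigma> (g \<otimes> h) k = \<sigma> g (h \<otimes> k) * \<sigma> h k"
  using two_cocycle by (simp add: two_cocycle_def)

lemma cocycle_mult_cnj:
  assumes "g \<in> carrier G" "h \<in> carrier G"
  shows "\<sigma> g h * cnj (\<sigma> g h) = 1"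
  using cmod_cocycle[OF assms] by (simp add: complex_norm_square[symmetric])

lemma cocycle_inv_commute: "g \<in> carrier G \<Longrightarrow> \<sigma> (inv g) g = \<sigma> g (inv g)"
  using cocycle[of g "inv g" g] by (simp add: cocycle_one)

text \<open>The scalar identity behind antimultiplicativity of the involution, in a form without
  conjugates: two instances of the cocycle identity share the factor
  \<open>\<sigma> h (inv h \<otimes> inv g)\<close>, which is eliminated.\<close>

lemma cocycle_inv_mult:
  assumes g: "g \<in> carrier G" and h: "h \<in> carrier G"
  shows "\<sigma> g h * \<sigma> (g \<otimes> h) (inv (g \<otimes> h)) * \<sigma> (inv h) (inv g) = \<sigma> g (inv g) * \<sigma> h (inv h)"
proof -
  have "h \<otimes> (inv h \<otimes> inv g) = inv g"
    using g h by (simp add: m_assoc[symmetric])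
  then have "\<sigma> g h * \<sigma> (g \<otimes> h) (inv (g \<otimes> h)) = \<sigma> g (inv g) * \<sigma> h (inv h \<otimes> inv g)"
    using cocycle[of g h "inv (g \<otimes> h)"] g h by (simp add: inv_mult_group)
  \<comment> \<open>The left side of the cocycle identity also contains
    \<open>\<sigma> \<one> (inv g)\<close>, which is 1 by normalisation.\<close>
  moreover have "\<sigma> h (inv h) = \<sigma> h (inv h \<otimes> inv g) * \<sigma> (inv h) (inv g)"
    using cocycle[of h "inv h" "inv g"] g h by (simp add: cocycle_one)
  ultimately show ?thesis
    by simp
qed

text \<open>The previous identity solved for the scalars that occur on the two sides of
  \<open>twisted_star_mul\<close>; conjugation is inversion on the circle.\<close>

lemma cnj_cocycle_inv_mult:
  assumes g: "g \<in> carrier G" and h: "h \<in> carrier G"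
  shows "cnj (\<sigma> (g \<otimes> h) (inv (g \<otimes> h))) * cnj (\<sigma> g h) =
    \<sigma> (inv h) (inv g) * (cnj (\<sigma> h (inv h)) * cnj (\<sigma> g (inv g)))"
proof -
  let ?a = "\<sigma> g h" and ?b = "\<sigma> (g \<otimes> h) (inv (g \<otimes> h))" and ?c = "\<sigma> (inv h) (inv g)"
  \<comment> \<open>Inserts \<open>?c * cnj ?c = 1\<close>, so that the product in
    \<open>cocycle_inv_mult\<close> appears under the conjugate.\<close>
  have "cnj ?b * cnj ?a = ?c * cnj (?a * ?b * ?c)"
    using cocycle_mult_cnj[of "inv h" "inv g"] g h by simp
  then show ?thesis
    unfolding cocycle_inv_mult[OF g h] by (simp add: mult_ac)
qed

lemma twisted_mul_closed: "b \<in> B \<Longrightarrow> c \<in> B \<Longrightarrow> twisted_mul b c \<in> B"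
  and proj_twisted_mul: "b \<in> B \<Longrightarrow> c \<in> B \<Longrightarrow> p (twisted_mul b c) = p b \<otimes> p c"
  by (simp_all add: twisted_mul_def smul_closed mul_closed proj_smul proj_mul)

lemma twisted_star_closed: "b \<in> B \<Longrightarrow> twisted_star b \<in> B"
  and proj_twisted_star: "b \<in> B \<Longrightarrow> p (twisted_star b) = inv (p b)"
  by (simp_all add: twisted_star_def smul_closed star_closed proj_smul proj_star)

lemma twisted_mul_fibre_one:
  "b \<in> fibre B p \<one> \<Longrightarrow> c \<in> fibre B p \<one> \<Longrightarrow> twisted_mul b c = mul b c"
  by (auto simp: fibre_def twisted_mul_def cocycle_one smul_one mul_closed)

lemma twisted_star_fibre_one: "b \<in> fibre B p \<one> \<Longrightarrow> twisted_star b = star b"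
  by (auto simp: fibre_def twisted_star_def cocycle_one smul_one star_closed)

text \<open>The scalars from the product and from the involution are conjugate to each other and
  cancel. The norm identity and positivity are thereby statements about an element of the old
  bundle.\<close>

lemma twisted_star_mul_self:
  assumes b: "b \<in> B"
  shows "twisted_mul (twisted_star b) b = mul (star b) b"
  \<comment> \<open>The product is unfolded first, with \<open>twisted_star b\<close> still folded,
    so that its projection is rewritten to \<open>inv (p b)\<close>.\<close>
  using b cocycle_mult_cnj[of "p b" "inv (p b)"]
  by (simp add: twisted_mul_def proj_twisted_star)
    (simp add: twisted_star_def cocycle_inv_commute mul_smul_left smul_smul smul_one
      star_closed mul_closed proj_closed)

text \<open>Conjugate linearity of \<open>star\<close> turns the inner scalar into
  \<open>\<sigma> (p b) (inv (p b))\<close>, which the outer scalar cancels by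
  \<open>cocycle_inv_commute\<close>.\<close>

lemma twisted_star_star:
  assumes b: "b \<in> B"
  shows "twisted_star (twisted_star b) = b"
proof -
  have "twisted_star (twisted_star b) = smul (cnj (\<sigma> (inv (p b)) (p b))) (star (twisted_star b))"
    using b by (simp add: twisted_star_def[of "twisted_star b"] proj_twisted_star proj_closed)
  also have "\<dots> = b"
    using b cocycle_mult_cnj[of "p b" "inv (p b)"]
    by (simp add: twisted_star_def star_smul star_closed star_star smul_smul smul_one proj_closed
        cocycle_inv_commute mult.commute)
  finally show ?thesis .
qed

lemma twisted_star_mul:
  assumes b: "b \<in> B" and c: "c \<in> B"
  shows "twisted_star (twisted_mul b c) = twisted_mul (twisted_star c) (twisted_star b)"
proof -
  let ?g = "p b" and ?h = "p c"
  have "twisted_star (twisted_mul b c) =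
      smul (cnj (\<sigma> (?g \<otimes> ?h) (inv (?g \<otimes> ?h))) * cnj (\<sigma> ?g ?h)) (mul (star c) (star b))"
    unfolding twisted_star_def proj_twisted_mul[OF b c]
    using b c by (simp add: twisted_mul_def star_smul star_mul mul_closed star_closed smul_smul)
  also have "\<dots> = smul (\<sigma> (inv ?h) (inv ?g) * (cnj (\<sigma> ?h (inv ?h)) * cnj (\<sigma> ?g (inv ?g))))
      (mul (star c) (star b))"
    using b c by (simp add: cnj_cocycle_inv_mult proj_closed)
  also have "\<dots> = twisted_mul (twisted_star c) (twisted_star b)"
    unfolding twisted_mul_def proj_twisted_star[OF b] proj_twisted_star[OF c]
    using b c by (simp add: twisted_star_def mul_smul_left mul_smul_right smul_smul smul_closed
        star_closed mul_closed mult.commute)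
  finally show ?thesis .
qed

text \<open>Once all scalars are pulled out, those of the two bracketings are the two sides of the
  cocycle identity.\<close>

lemma twisted_mul_assoc:
  assumes b: "b \<in> B" and c: "c \<in> B" and d: "d \<in> B"
  shows "twisted_mul (twisted_mul b c) d = twisted_mul b (twisted_mul c d)"
proof -
  have "twisted_mul (twisted_mul b c) d =
      smul (\<sigma> (p b) (p c) * \<sigma> (p b \<otimes> p c) (p d)) (mul (mul b c) d)"
    unfolding twisted_mul_def[of "twisted_mul b c"] proj_twisted_mul[OF b c]
    using b c d by (simp add: twisted_mul_def mul_smul_left smul_smul mul_closed mult.commute)
  also have "\<dots> = smul (\<sigma> (p b) (p c \<otimes> p d) * \<sigma> (p c) (p d)) (mul b (mul c d))"
    using b c d by (simp add: cocycle mul_assoc proj_closed)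
  also have "\<dots> = twisted_mul b (twisted_mul c d)"
    unfolding twisted_mul_def[of b "twisted_mul c d"] proj_twisted_mul[OF c d]
    using b c d by (simp add: twisted_mul_def mul_smul_right smul_smul mul_closed)
  finally show ?thesis .
qed

theorem fell_bundle_twisted:
  "fell_bundle G B p add zero smul nrm twisted_mul twisted_star"
proof unfold_locales
  fix g h b b' c
  assume g: "g \<in> carrier G" and h: "h \<in> carrier G"
    and b: "b \<in> fibre B p g" and b': "b' \<in> fibre B p g" and c: "c \<in> fibre B p h"
  \<comment> \<open>All three products carry the same scalar \<open>\<sigma> g h\<close>, which
    distributes over the sum in the fibre over \<open>g \<otimes> h\<close>.\<close>
  have "p (add b b') = g" "p b = g" "p b' = g" "p c = h"
    using add_fibre[OF g b b'] b b' c by (auto simp: fibre_def)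
  then show "twisted_mul (add b b') c = add (twisted_mul b c) (twisted_mul b' c)"
    using smul_add[OF _ mul_fibre[OF b c] mul_fibre[OF b' c]] g h
    by (simp add: twisted_mul_def mul_add_left[OF g h b b' c])
next
  fix g h b c c'
  assume g: "g \<in> carrier G" and h: "h \<in> carrier G"
    and b: "b \<in> fibre B p g" and c: "c \<in> fibre B p h" and c': "c' \<in> fibre B p h"
  have "p (add c c') = h" "p b = g" "p c' = h" "p c = h"
    using add_fibre[OF h c c'] b c c' by (auto simp: fibre_def)
  then show "twisted_mul b (add c c') = add (twisted_mul b c) (twisted_mul b c')"
    using smul_add[OF _ mul_fibre[OF b c] mul_fibre[OF b c']] g h
    by (simp add: twisted_mul_def mul_add_right[OF g h b c c'])
next
  fix g b c
  assume g: "g \<in> carrier G" and b: "b \<in> fibre B p g" and c: "c \<in> fibre B p g"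
  have "p (add b c) = g" "p b = g" "p c = g"
    using add_fibre[OF g b c] b c by (auto simp: fibre_def)
  then show "twisted_star (add b c) = add (twisted_star b) (twisted_star c)"
    using smul_add[OF _ star_fibre[OF g b] star_fibre[OF g c]] g
    by (simp add: twisted_star_def star_add[OF g b c])
next
  fix g b
  assume "g \<in> carrier G" "b \<in> fibre B p g"
  then show "twisted_star b \<in> fibre B p (inv g)"
    by (auto simp: fibre_def twisted_star_closed proj_twisted_star)
next
  fix b c l
  assume b: "b \<in> B" and c: "c \<in> B"
  show "twisted_mul (smul l b) c = smul l (twisted_mul b c)"
    "twisted_mul b (smul l c) = smul l (twisted_mul b c)"
    using b c by (simp_all add: twisted_mul_def proj_smul mul_smul_left mul_smul_right smul_smul
        mul_closed mult.commute)
  show "nrm (twisted_mul b c) \<le> nrm b * nrm c"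
    using b c by (simp add: twisted_mul_def nrm_smul mul_closed cmod_cocycle proj_closed nrm_mul)
next
  fix b l
  assume b: "b \<in> B"
  show "twisted_star (smul l b) = smul (cnj l) (twisted_star b)"
    using b by (simp add: twisted_star_def proj_smul star_smul smul_smul star_closed mult.commute)
  show "nrm (twisted_mul (twisted_star b) b) = (nrm b)\<^sup>2"
    using b by (simp add: twisted_star_mul_self nrm_star_mul)
  show "cstar_positive (fibre B p \<one>) add (zero \<one>) smul twisted_mul twisted_star
      (twisted_mul (twisted_star b) b)"
    \<comment> \<open>The element is the old one, and on the fibre over the identity so are the
      operations that define positivity.\<close>
    using star_mul_positive[OF b]
      cstar_positive_cong[of "fibre B p \<one>" twisted_mul mul twisted_star star]
    by (simp add: twisted_star_mul_self[OF b] twisted_mul_fibre_one twisted_star_fibre_one)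
qed (simp_all add: twisted_mul_closed proj_twisted_mul twisted_mul_assoc twisted_star_star
    twisted_star_mul)

end

theorem proposition3p3:
  fixes G :: "('g, 'm) monoid_scheme" (structure)
    and B :: "'b set" and p :: "'b \<Rightarrow> 'g"
    and add :: "'b \<Rightarrow> 'b \<Rightarrow> 'b" and zero :: "'g \<Rightarrow> 'b"
    and smul :: "complex \<Rightarrow> 'b \<Rightarrow> 'b" and nrm :: "'b \<Rightarrow> real"
    and mul :: "'b \<Rightarrow> 'b \<Rightarrow> 'b" and star :: "'b \<Rightarrow> 'b"
    and \<sigma> :: "'g \<Rightarrow> 'g \<Rightarrow> complex"
  assumes "fell_bundle G B p add zero smul nrm mul star"
    and "two_cocycle G \<sigma>"
  shows "\<exists>mul\<sigma> star\<sigma>.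
    fell_bundle G B p add zero smul nrm mul\<sigma> star\<sigma> \<and>
    (\<forall>g\<in>carrier G. \<forall>h\<in>carrier G. \<forall>b\<in>fibre B p g. \<forall>c\<in>fibre B p h.
      mul\<sigma> b c = smul (\<sigma> g h) (mul b c)) \<and>
    (\<forall>g\<in>carrier G. \<forall>b\<in>fibre B p g.
      star\<sigma> b = smul (cnj (\<sigma> g (inv g))) (star b))"
proof -
  interpret twisted_fell_bundle G B p add zero smul nrm mul star \<sigma>
    using assms by (intro twisted_fell_bundle.intro twisted_fell_bundle_axioms.intro)
  show ?thesis
    using fell_bundle_twisted
    by (intro exI[of _ twisted_mul] exI[of _ twisted_star])
      (auto simp: fibre_def twisted_mul_def twisted_star_def)
qed

end
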